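(* Let $\Gamma\le\langle(1,2,\dots,n)\rangle$ be a subgroup of the cyclic group generated by the $n$-cycle $(1,2,\dots,n)$, and let $I_0,I_1\subsetneq[n]$ with $I_0\cup I_1\subsetneq[n]$ be disjoint index sets defining a complete set of fixings for every permutation in $\Gamma$. If $\mathcal X_\Gamma\cap F(I_0,I_1)$ is non-empty, then there exists $x\in F(I_0,I_1)$ such that $x\succ\gamma(x)$ for all $\gamma\in\Gamma\setminus\{\mathrm{id}\}$.
   Context: $[n]=\{1,\dots,n\}$. A permutation $\gamma$ of $[n]$ acts on $x\in\mathbb R^n$ by $\gamma(x)=(x_{\gamma^{-1}(1)},\dots,x_{\gamma^{-1}(n)})$. $x\succ y$ (resp. $x\succeq y$) means that $x$ is lexicographically greater (resp. not smaller) than $y$. $\mathcal X_\gamma=\{x\in\{0,1\}^n : x\succeq\gamma(x)\}$ and $\mathcal X_\Gamma=\bigcap_{\gamma\in\Gamma}\mathcal X_\gamma$. For disjoint $I_0,I_1\subseteq[n]$, $F(I_0,I_1)=\{x\in\{0,1\}^n : x_i=0 \text{ for } i\in I_0,\ x_i=1\text{ for } i\in I_1\}$. The pair $(I_0,I_1)$ defines a complete set of fixings for the permutation $\gamma$ if there is no pair $(i,b)$ with $i\in[n]\setminus(I_0\cup I_1)$ and $b\in\{0,1\}$ such that all $x\in\mathcal X_\gamma\cap F(I_0,I_1)$ satisfy $x_i=b$. *)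

theory Defs
  imports "HOL-Algebra.Algebra" "HOL-Library.Fun_Lexorder"
begin

text \<open>A vector in \<open>R^n\<close> is a function on \<open>{1..n}\<close> that is \<open>undefined\<close> elsewhere, that is,
  an element of \<open>{1..n} \<rightarrow>\<^sub>E UNIV\<close>.\<close>

definition cube :: "nat \<Rightarrow> (nat \<Rightarrow> real) set" where
  "cube n = ({1..n} \<rightarrow>\<^sub>E {0, 1})"

text \<open>As \<open>\<gamma>\<close> permutes \<open>{1..n}\<close>, it fixes all other indices, so the action preserves
  \<open>{1..n} \<rightarrow>\<^sub>E UNIV\<close>.\<close>

definition perm_act :: "(nat \<Rightarrow> nat) \<Rightarrow> (nat \<Rightarrow> real) \<Rightarrow> (nat \<Rightarrow> real)" where
  "perm_act \<gamma> x = (\<lambda>i. x (inv_into UNIV \<gamma> i))"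

text \<open>\<^const>\<open>less_fun\<close> compares functions on all of \<open>nat\<close>. Two vectors in \<open>{1..n} \<rightarrow>\<^sub>E UNIV\<close>
  agree outside \<open>{1..n}\<close>, so on them it is the lexicographic order of \<open>R^n\<close>; see
  \<open>lex_greater_iff\<close>.\<close>

abbreviation lex_greater :: "(nat \<Rightarrow> real) \<Rightarrow> (nat \<Rightarrow> real) \<Rightarrow> bool" (infix "\<succ>\<^sub>l" 50) where
  "x \<succ>\<^sub>l y \<equiv> less_fun y x"

abbreviation lex_geq :: "(nat \<Rightarrow> real) \<Rightarrow> (nat \<Rightarrow> real) \<Rightarrow> bool" (infix "\<succeq>\<^sub>l" 50) where
  "x \<succeq>\<^sub>l y \<equiv> \<not> less_fun x y"

lemma lex_greater_iff:
  assumes "x \<in> {1..n} \<rightarrow>\<^sub>E UNIV" "y \<in> {1..n} \<rightarrow>\<^sub>E UNIV"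
  shows "x \<succ>\<^sub>l y \<longleftrightarrow> (\<exists>k\<in>{1..n}. x k > y k \<and> (\<forall>j\<in>{1..<k}. x j = y j))"
proof -
  have eq: "x i = y i" if "i \<notin> {1..n}" for i
    using that assms by (simp add: PiE_def extensional_def)
  show ?thesis
  proof
    assume "x \<succ>\<^sub>l y"
    then obtain k where "y k < x k" "\<forall>j<k. y j = x j"
      unfolding less_fun_def by blast
    moreover from this eq have "k \<in> {1..n}" by fastforce
    ultimately show "\<exists>k\<in>{1..n}. x k > y k \<and> (\<forall>j\<in>{1..<k}. x j = y j)"
      by auto
  next
    assume "\<exists>k\<in>{1..n}. x k > y k \<and> (\<forall>j\<in>{1..<k}. x j = y j)"
    then obtain k where k: "k \<in> {1..n}" "y k < x k" "\<forall>j\<in>{1..<k}. x j = y j"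
      by blast
    have "y j = x j" if "j < k" for j
      using that k eq[of j] by (cases "j = 0") auto
    with k show "x \<succ>\<^sub>l y"
      unfolding less_fun_def by blast
  qed
qed

definition lex_max_perm :: "nat \<Rightarrow> (nat \<Rightarrow> nat) \<Rightarrow> (nat \<Rightarrow> real) set" where
  "lex_max_perm n \<gamma> = {x \<in> cube n. x \<succeq>\<^sub>l perm_act \<gamma> x}"

definition lex_max_group :: "nat \<Rightarrow> (nat \<Rightarrow> nat) set \<Rightarrow> (nat \<Rightarrow> real) set" where
  "lex_max_group n \<Gamma> = (\<Inter>\<gamma>\<in>\<Gamma>. lex_max_perm n \<gamma>)"

definition face :: "nat \<Rightarrow> nat set \<Rightarrow> nat set \<Rightarrow> (nat \<Rightarrow> real) set" where
  "face n I0 I1 = {x \<in> cube n. (\<forall>i\<in>I0. x i = 0) \<and> (\<forall>i\<in>I1. x i = 1)}"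

definition complete_fixings :: "nat \<Rightarrow> (nat \<Rightarrow> nat) \<Rightarrow> nat set \<Rightarrow> nat set \<Rightarrow> bool" where
  "complete_fixings n \<gamma> I0 I1 \<longleftrightarrow>
     \<not> (\<exists>i\<in>{1..n} - (I0 \<union> I1). \<exists>b\<in>{0, 1}. \<forall>x\<in>lex_max_perm n \<gamma> \<inter> face n I0 I1. x i = b)"

definition cyclic_perm_group :: "nat \<Rightarrow> (nat \<Rightarrow> nat) monoid" where
  "cyclic_perm_group n = subgroup_generated (sym_group n) {cycle_of_list [1..<Suc n]}"

lemma cycle_of_list_upt:
  assumes "i \<in> {1..n}"
  shows "cycle_of_list [1..<Suc n] i = (if i = n then 1 else Suc i)"
proof -
  have len: "length [1..<Suc n] = n" and dist: "distinct [1..<Suc n]" by auto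
  have "map (cycle_of_list [1..<Suc n]) [1..<Suc n] = rotate1 [1..<Suc n]"
    using cyclic_rotation[of "[1..<Suc n]" 1] by simp
  then have "cycle_of_list [1..<Suc n] ([1..<Suc n] ! (i - 1)) = rotate1 [1..<Suc n] ! (i - 1)"
    using assms len nth_map[of "i - 1" "[1..<Suc n]" "cycle_of_list [1..<Suc n]"] by auto
  moreover have "[1..<Suc n] ! (i - 1) = i"
    using assms nth_upt[of 1 "i - 1" "Suc n"] by auto
  moreover have "rotate1 [1..<Suc n] ! (i - 1) = (if i = n then 1 else Suc i)"
  proof -
    have "i - 1 < length [1..<Suc n]" using assms by auto
    then have "rotate1 [1..<Suc n] ! (i - 1) = [1..<Suc n] ! (Suc (i - 1) mod n)"
      by (simp only: nth_rotate1 len)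
    also have "Suc (i - 1) mod n = (if i = n then 0 else i)" using assms by auto
    finally show ?thesis
      using assms nth_upt[of 1 0 "Suc n"] nth_upt[of 1 i "Suc n"] by (auto split: if_splits)
  qed
  ultimately show ?thesis by simp
qed

end

theory Submission
  imports Defs
begin

text \<open>Let \<open>p\<close> be the first free index, and let \<open>x\<close> be \<open>1\<close> at \<open>p\<close> and \<open>0\<close> at all other free
  indices. Completeness of the fixings for \<open>\<gamma>\<close> at \<open>p\<close> shows that \<open>x\<close> and \<open>\<gamma>(x)\<close> cannot have a
  first difference in the wrong direction at a position up to \<open>p\<close>, and that they can agree up to
  \<open>p\<close> only if \<open>\<gamma>\<inverse>\<close> is the rotation \<open>i \<mapsto> i + s\<close> for some \<open>s < p\<close>. In that case the entries of \<open>x\<close> before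
  the first difference \<open>k\<close> have period \<open>s\<close>, so \<open>x\<close> and \<open>\<gamma>\<^sup>2(x)\<close> first differ at \<open>k - s\<close>, in the
  same direction; by descent \<open>x \<succeq> \<gamma>(x)\<close> for all \<open>\<gamma>\<close>. If \<open>x\<close> is fixed by a nontrivial \<open>\<gamma>\<close>,
  then \<open>x\<close> has a period smaller than \<open>p\<close>, every strict comparison is decided before \<open>p\<close>, and
  changing \<open>x\<^sub>p\<close> to \<open>0\<close> preserves these and makes the ties strict.\<close>

section \<open>Rotations\<close>

text \<open>Addition of \<open>s\<close> modulo \<open>n\<close> on the representatives
  \<open>1..n\<close>. Both \<open>s = 0\<close> and \<open>s = n\<close> give the identity, so
  \<open>n - s\<close> always names the inverse.\<close>

definition rot :: "nat \<Rightarrow> nat \<Rightarrow> nat \<Rightarrow> nat" where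
  "rot n s i = (if i \<in> {1..n} then if i + s \<le> n then i + s else i + s - n else i)"

lemma rot_0: "rot n 0 = id"
  by (auto simp: rot_def fun_eq_iff)

lemma rot_self: "rot n n = id"
  by (auto simp: rot_def fun_eq_iff)

lemma rot_comp:
  assumes "s \<le> n" "t \<le> n"
  shows "rot n s \<circ> rot n t = rot n (if s + t \<le> n then s + t else s + t - n)"
  using assms by (auto simp: rot_def fun_eq_iff)

lemma rot_commute:
  assumes "s \<le> n" "t \<le> n"
  shows "rot n s (rot n t i) = rot n t (rot n s i)"
  using rot_comp[OF assms] rot_comp[OF assms(2,1)] by (simp add: fun_eq_iff add.commute)

lemma rot_fixpoint_free:
  assumes "s \<le> n" "rot n s \<noteq> id" "i \<in> {1..n}"
  shows "rot n s i \<noteq> i"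
proof -
  have "s \<noteq> 0" "s \<noteq> n"
    using assms(2) rot_0 rot_self by metis+
  then show ?thesis
    using assms by (auto simp: rot_def)
qed

lemma inv_rot:
  assumes "s \<le> n"
  shows "inv_into UNIV (rot n s) = rot n (n - s)"
proof (rule inv_unique_comp)
  show "rot n s \<circ> rot n (n - s) = id" "rot n (n - s) \<circ> rot n s = id"
    using rot_comp[of s n "n - s"] rot_comp[of "n - s" n s] assms by (auto simp: rot_self)
qed

lemma cycle_eq_rot: "cycle_of_list [1..<Suc n] = rot n 1"
proof
  fix i
  show "cycle_of_list [1..<Suc n] i = rot n 1 i"
  proof (cases "i \<in> {1..n}")
    case True
    then show ?thesis
      using cycle_of_list_upt[OF True] by (auto simp: rot_def)
  next
    case False
    then show ?thesis
      using id_outside_supp[of i "[1..<Suc n]"] by (auto simp: rot_def)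
  qed
qed

lemma mult_cyclic_perm_group: "f \<otimes>\<^bsub>cyclic_perm_group n\<^esub> g = f \<circ> g"
  by (simp add: cyclic_perm_group_def sym_group_def)

lemma cyclic_perm_group_rot:
  assumes "n \<ge> 1" "\<gamma> \<in> carrier (cyclic_perm_group n)"
  shows "\<exists>s\<le>n. \<gamma> = rot n s"
proof -
  interpret G: group "sym_group n"
    by (rule sym_group_is_group)
  have "\<gamma> \<in> generate (sym_group n) (carrier (sym_group n) \<inter> {rot n 1})"
    using assms(2)
    unfolding cyclic_perm_group_def carrier_subgroup_generated cycle_eq_rot .
  then show ?thesis
  proof induction
    case one
    then show ?case
      by (metis rot_0 le0 sym_group_one)
  next
    case (incl h)
    then show ?case
      using assms(1) by auto
  next
    case (inv h)
    then have "inv\<^bsub>sym_group n\<^esub> h = rot n (n - 1)"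
      using assms(1) inv_rot[of 1 n] sym_group_inv_equality[of h n] by auto
    then show ?case
      by (metis diff_le_self)
  next
    case (eng h1 h2)
    then obtain s t where "s \<le> n" "t \<le> n" "h1 = rot n s" "h2 = rot n t"
      by auto
    then show ?case
      using rot_comp[of s n t]
      by (intro exI[of _ "if s + t \<le> n then s + t else s + t - n"]) (auto simp: sym_group_mult)
  qed
qed

section \<open>Lexicographic comparison with rotated vectors\<close>

text \<open>The first strict inequality, at \<open>k\<close> or earlier, decides the
  comparison.\<close>

lemma less_funI_le:
  fixes u v :: "nat \<Rightarrow> real"
  assumes "\<And>j. j < k \<Longrightarrow> u j \<le> v j" "u k < v k"
  shows "less_fun u v"
proof -
  define m where "m = (LEAST j. u j < v j)"
  have "u m < v m" "m \<le> k"
    unfolding m_def using assms(2) by (rule LeastI, rule Least_le)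
  moreover have "u j = v j" if "j < m" for j
    using assms(1)[of j] not_less_Least[OF that[unfolded m_def]] that \<open>m \<le> k\<close> by simp
  ultimately show ?thesis
    unfolding less_fun_def by blast
qed

lemma first_difference:
  fixes u v :: "nat \<Rightarrow> 'a"
  assumes "u \<noteq> v"
  obtains k where "u k \<noteq> v k" "\<And>j. j < k \<Longrightarrow> u j = v j"
proof -
  obtain k where "u k \<noteq> v k" "\<forall>j<k. \<not> u j \<noteq> v j"
    using assms exists_least_iff[of "\<lambda>k. u k \<noteq> v k"] by (auto simp: fun_eq_iff)
  then show thesis
    using that by blast
qed

text \<open>\<open>T\<close> consists of the inverses of the elements of \<open>\<Gamma>\<close>, so that \<open>\<gamma>(x)\<close> becomes \<open>x \<circ> f\<close>.\<close>

locale complete_rotations =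
  fixes n p :: nat and I0 I1 :: "nat set" and T :: "(nat \<Rightarrow> nat) set"
  assumes disjoint: "I0 \<inter> I1 = {}"
    and p_free: "p \<in> {1..n} - (I0 \<union> I1)"
    and below_p: "\<And>i. i \<in> {1..<p} \<Longrightarrow> i \<in> I0 \<union> I1"
    and rotations: "\<And>f. f \<in> T \<Longrightarrow> \<exists>s\<le>n. f = rot n s"
    and comp_closed: "\<And>f. f \<in> T \<Longrightarrow> f \<circ> f \<in> T"
    and complete_p: "\<And>f b. f \<in> T \<Longrightarrow> b \<in> {0, 1} \<Longrightarrow>
      \<exists>z\<in>face n I0 I1. z p = b \<and> \<not> less_fun z (z \<circ> f)"
begin

section \<open>The candidate vector and the face\<close>

definition sparse :: "nat \<Rightarrow> real" where
  "sparse i = (if i \<in> {1..n} then if i \<in> insert p I1 then 1 else 0 else undefined)"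

lemma sparse_p: "sparse p = 1"
  using p_free by (auto simp: sparse_def)

lemma sparse_in_face: "sparse \<in> face n I0 I1"
  if "I0 \<subseteq> {1..n}" "I1 \<subseteq> {1..n}"
  using that disjoint p_free
  by (auto simp: face_def cube_def sparse_def PiE_iff extensional_def)

lemma sparse_eq_face:
  assumes "z \<in> face n I0 I1" "i < p"
  shows "sparse i = z i"
  using assms below_p[of i] p_free disjoint
  by (cases "i = 0") (auto simp: face_def cube_def sparse_def PiE_def extensional_def)

text \<open>Free entries of \<open>sparse\<close> other than \<open>p\<close> are 0, so
  \<open>z p = 1\<close> matters only at \<open>p\<close> itself. The conditional form also serves
  points with \<open>z p = 0\<close>.\<close>

lemma sparse_le_face:
  assumes "z \<in> face n I0 I1" "i = p \<Longrightarrow> z p = 1"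
  shows "sparse i \<le> z i"
proof (cases "i \<in> {1..n}")
  case True
  then have "z i \<in> {0, 1}"
    using assms(1) by (auto simp: face_def cube_def)
  then show ?thesis
    using True assms by (auto simp: sparse_def face_def)
next
  case False
  then show ?thesis
    using assms(1) by (auto simp: sparse_def face_def cube_def PiE_def extensional_def)
qed

section \<open>Comparison of the candidate with its rotations\<close>

lemma sparse_range: "i \<in> {1..n} \<Longrightarrow> sparse i \<in> {0, 1}"
  by (simp add: sparse_def)

lemma difference_in_range:
  assumes "f \<in> T" "sparse k \<noteq> sparse (f k)"
  shows "k \<in> {1..n}" "f k \<in> {1..n}"
proof -
  obtain s where "s \<le> n" "f = rot n s"
    using rotations assms(1) by blast
  then show "k \<in> {1..n}" "f k \<in> {1..n}"
    using assms(2) by (auto simp: rot_def split: if_splits)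
qed

text \<open>A point \<open>z\<close> with \<open>z p = 1\<close> agrees with \<open>sparse\<close>
  before \<open>p\<close> and dominates it everywhere, so a wrong first difference would carry over
  to \<open>z\<close>.\<close>

lemma not_less_up_to_p:
  assumes "f \<in> T" "k \<le> p" "\<And>j. j < k \<Longrightarrow> sparse j = sparse (f j)"
  shows "\<not> sparse k < sparse (f k)"
proof
  assume less: "sparse k < sparse (f k)"
  then have "k \<in> {1..n}" "f k \<in> {1..n}"
    using difference_in_range[OF assms(1)] by auto
  with less have "sparse k = 0"
    using sparse_range[of k] sparse_range[of "f k"] by auto
  then have "k < p"
    using sparse_p assms(2) by (cases "k = p") auto
  obtain z where z: "z \<in> face n I0 I1" "z p = 1" "\<not> less_fun z (z \<circ> f)"
    using complete_p[OF assms(1), of 1] by auto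
  have "z j \<le> (z \<circ> f) j" if "j < k" for j
    using sparse_eq_face[OF z(1), of j] sparse_le_face[OF z(1), of "f j"] assms(3)[OF that]
      z(2) that \<open>k < p\<close> by simp
  moreover have "z k < (z \<circ> f) k"
    using sparse_eq_face[OF z(1) \<open>k < p\<close>] sparse_le_face[OF z(1), of "f k"] less z(2) by simp
  ultimately show False
    using less_funI_le z(3) by blast
qed

text \<open>Otherwise a point \<open>z\<close> with \<open>z p = 0\<close> is at most
  \<open>z \<circ> f\<close> before \<open>p\<close>, and at \<open>p\<close> it has 0 against 1,
  since \<open>f p\<close> differs from \<open>p\<close>.\<close>

lemma preimage_p:
  assumes "f \<in> T" "f \<noteq> id" "\<And>j. j \<le> p \<Longrightarrow> sparse j = sparse (f j)"
  obtains j where "j < p" "f j = p"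
proof -
  have False if no: "\<And>j. j < p \<Longrightarrow> f j \<noteq> p"
  proof -
    obtain z where z: "z \<in> face n I0 I1" "z p = 0" "\<not> less_fun z (z \<circ> f)"
      using complete_p[OF assms(1), of 0] by auto
    have "f p \<noteq> p"
      using rotations[OF assms(1)] rot_fixpoint_free assms(2) p_free by blast
    have "z j \<le> (z \<circ> f) j" if "j < p" for j
      using sparse_eq_face[OF z(1), of j] sparse_le_face[OF z(1), of "f j"] assms(3)[of j]
        no[OF that] that by simp
    moreover have "z p < (z \<circ> f) p"
      using sparse_le_face[OF z(1), of "f p"] assms(3)[of p] sparse_p z(2) \<open>f p \<noteq> p\<close> by simp
    ultimately show False
      using less_funI_le z(3) by blast
  qed
  then show thesis
    using that by blast
qed

lemma small_rotation:
  assumes "f \<in> T" "f \<noteq> id" "\<And>j. j \<le> p \<Longrightarrow> sparse j = sparse (f j)"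
  obtains s where "0 < s" "s < p" "f = rot n s"
proof -
  obtain s where s: "s \<le> n" "f = rot n s"
    using rotations[OF assms(1)] by blast
  have "s \<noteq> 0" "s \<noteq> n"
    using assms(2) s(2) rot_0 rot_self by metis+
  obtain j where "j < p" "f j = p"
    using preimage_p[OF assms] by blast
  \<comment> \<open>Wrapping around never raises an index, so \<open>j + s = p\<close> with
    \<open>j \<ge> 1\<close>.\<close>
  then have "s < p"
    using s \<open>s \<noteq> n\<close> p_free by (auto simp: rot_def split: if_splits)
  then show thesis
    using that s(2) \<open>s \<noteq> 0\<close> by blast
qed

lemma not_less:
  assumes "f \<in> T" "\<And>j. j < k \<Longrightarrow> sparse j = sparse (f j)"
  shows "\<not> sparse k < sparse (f k)"
  using assms
proof (induction k arbitrary: f rule: less_induct)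
  case (less k)
  show ?case
  proof
    assume diff: "sparse k < sparse (f k)"
    then have "p < k"
      using not_less_up_to_p[of f k] less.prems by (meson not_le)
    then obtain s where s: "0 < s" "s < p" "f = rot n s"
      using small_rotation[of f] less.prems diff
      by (metis id_apply le_less_trans less_irrefl)
    have "k \<le> n"
      using difference_in_range[OF less.prems(1), of k] diff by auto
    have shift: "f i = i + s" if "1 \<le> i" "i \<le> k - s" for i
      using that s \<open>p < k\<close> \<open>k \<le> n\<close> by (auto simp: rot_def)
    \<comment> \<open>For \<open>j > 0\<close>, both \<open>j\<close> and \<open>f j = j + s\<close>
      lie below \<open>k\<close>, so the agreement applies twice.\<close>
    have "sparse j = sparse ((f \<circ> f) j)" if "j < k - s" for j
    proof (cases "j = 0")
      case True
      then show ?thesis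
        using s(3) by (simp add: rot_def)
    next
      case False
      then show ?thesis
        using less.prems(2)[of j] less.prems(2)[of "f j"] shift[of j] that by simp
    qed
    then have "\<not> sparse (k - s) < sparse ((f \<circ> f) (k - s))"
      using less.IH[OF _ comp_closed[OF less.prems(1)]] s \<open>p < k\<close> by simp
    moreover have "f (k - s) = k" "sparse (k - s) = sparse k"
      using less.prems(2)[of "k - s"] shift[of "k - s"] s \<open>p < k\<close> by simp_all
    ultimately show False
      using diff by simp
  qed
qed

lemma first_difference_sparse:
  assumes "f \<in> T" "sparse \<circ> f \<noteq> sparse"
  shows "\<exists>k. sparse (f k) < sparse k \<and> (\<forall>j<k. sparse j = sparse (f j))"
proof -
  obtain k where k: "sparse k \<noteq> (sparse \<circ> f) k" "\<And>j. j < k \<Longrightarrow> sparse j = (sparse \<circ> f) j"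
    using first_difference[OF assms(2)[symmetric]] by blast
  then have "sparse (f k) < sparse k"
    using not_less[OF assms(1), of k] by simp
  then show ?thesis
    using k(2) by auto
qed

section \<open>Making all comparisons strict\<close>

lemma strict_solution:
  assumes "I0 \<subseteq> {1..n}" "I1 \<subseteq> {1..n}"
  shows "\<exists>x\<in>face n I0 I1. \<forall>f\<in>T - {id}. less_fun (x \<circ> f) x"
proof (cases "\<exists>f\<in>T - {id}. sparse \<circ> f = sparse")
  case False
  have "less_fun (sparse \<circ> f) sparse" if f: "f \<in> T - {id}" for f
  proof -
    obtain k where "sparse (f k) < sparse k" "\<And>j. j < k \<Longrightarrow> sparse j = sparse (f j)"
      using first_difference_sparse[of f] f False by auto
    then show ?thesis
      by (intro less_funI_le[of k]) auto
  qed
  then show ?thesis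
    using sparse_in_face[OF assms] by blast
next
  case True
  then obtain f where f: "f \<in> T" "f \<noteq> id" "sparse \<circ> f = sparse"
    by blast
  have inv_f: "sparse (f j) = sparse j" for j
    using f(3) by (metis comp_apply)
  obtain s where s: "0 < s" "s < p" "f = rot n s"
    using small_rotation[OF f(1,2)] inv_f by metis
  define x where "x = sparse(p := 0)"
  have x_le: "x i \<le> sparse i" for i
    by (simp add: x_def sparse_p)
  have x_eq: "x i = sparse i" if "i \<noteq> p" for i
    using that by (simp add: x_def)
  have x_face: "x \<in> face n I0 I1"
    using sparse_in_face[OF assms] p_free
    by (auto simp: x_def face_def cube_def PiE_def extensional_def Pi_def)
  have "less_fun (x \<circ> g) x" if g: "g \<in> T - {id}" for g
  proof (cases "sparse \<circ> g = sparse")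
    case True
    then have inv_g: "sparse (g j) = sparse j" for j
      by (metis comp_apply)
    \<comment> \<open>The tie breaks at \<open>j\<close> at the latest: \<open>x j\<close> is still
      1, while \<open>x (g j) = x p = 0\<close>.\<close>
    obtain j where j: "j < p" "g j = p"
      using preimage_p[of g] g inv_g by (metis DiffE singletonI)
    have "(x \<circ> g) i \<le> x i" if "i < j" for i
      using x_le[of "g i"] x_eq[of i] inv_g[of i] that j(1) by simp
    moreover have "(x \<circ> g) j < x j"
      using x_eq[of j] inv_g[of j] j by (simp add: x_def sparse_p)
    ultimately show ?thesis
      by (rule less_funI_le)
  next
    case False
    then obtain k where k: "sparse (g k) < sparse k" "\<And>j. j < k \<Longrightarrow> sparse j = sparse (g j)"
      using first_difference_sparse[of g] g by auto
    \<comment> \<open>Otherwise \<open>k - s \<ge> 1\<close>; as \<open>f\<close> and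
      \<open>g\<close> commute and \<open>sparse\<close> is invariant under \<open>f\<close>, the
      difference at \<open>k\<close> already occurs at \<open>k - s\<close>.\<close>
    have "k < p"
    proof (rule ccontr)
      assume "\<not> k < p"
      have "k \<le> n"
        using difference_in_range[of g k] g k(1) by auto
      then have shift: "f (k - s) = k"
        using s \<open>\<not> k < p\<close> by (auto simp: rot_def)
      obtain t where "t \<le> n" "g = rot n t"
        using rotations g by blast
      then have "g k = f (g (k - s))"
        using rot_commute[of s n t "k - s"] shift s p_free by auto
      then have "sparse (g (k - s)) = sparse (g k)" "sparse (k - s) = sparse k"
        using inv_f[of "g (k - s)"] inv_f[of "k - s"] shift by simp_all
      then show False
        using k(1) k(2)[of "k - s"] s \<open>\<not> k < p\<close> by simp
    qed
    have "(x \<circ> g) i \<le> x i" if "i < k" for i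
      using x_le[of "g i"] x_eq[of i] k(2)[OF that] that \<open>k < p\<close> by simp
    moreover have "(x \<circ> g) k < x k"
      using x_le[of "g k"] x_eq[of k] k(1) \<open>k < p\<close> by simp
    ultimately show ?thesis
      by (rule less_funI_le)
  qed
  then show ?thesis
    using x_face by blast
qed

end

theorem proposition3p5:
  fixes n :: nat and \<Gamma> :: "(nat \<Rightarrow> nat) set" and I0 I1 :: "nat set"
  assumes "subgroup \<Gamma> (cyclic_perm_group n)"
    and "I0 \<subset> {1..n}" and "I1 \<subset> {1..n}" and "I0 \<union> I1 \<subset> {1..n}"
    and "I0 \<inter> I1 = {}"
    and "\<forall>\<gamma>\<in>\<Gamma>. complete_fixings n \<gamma> I0 I1"
    and "lex_max_group n \<Gamma> \<inter> face n I0 I1 \<noteq> {}"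
  shows "\<exists>x\<in>face n I0 I1. \<forall>\<gamma>\<in>\<Gamma> - {id}. x \<succ>\<^sub>l perm_act \<gamma> x"
proof -
  define p where "p = Min ({1..n} - (I0 \<union> I1))"
  have p: "p \<in> {1..n} - (I0 \<union> I1)"
    unfolding p_def using assms(4) by (intro Min_in) auto
  have below: "i \<in> I0 \<union> I1" if "i \<in> {1..<p}" for i
    using that p Min_le[of "{1..n} - (I0 \<union> I1)" i] unfolding p_def by fastforce
  have n: "n \<ge> 1"
    using p by auto
  have rots: "\<exists>s\<le>n. \<gamma> = rot n s" if "\<gamma> \<in> \<Gamma>" for \<gamma>
    using that assms(1) n cyclic_perm_group_rot subgroup.subset by blast
  have act: "perm_act \<gamma> x = x \<circ> inv_into UNIV \<gamma>" for \<gamma> x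
    by (auto simp: perm_act_def)
  interpret complete_rotations n p I0 I1 "inv_into UNIV ` \<Gamma>"
  proof
    show "\<exists>s\<le>n. f = rot n s" if "f \<in> inv_into UNIV ` \<Gamma>" for f
      using that rots inv_rot by (metis diff_le_self imageE)
  next
    fix f assume "f \<in> inv_into UNIV ` \<Gamma>"
    then obtain \<gamma> where \<gamma>: "\<gamma> \<in> \<Gamma>" "f = inv_into UNIV \<gamma>"
      by blast
    have "bij \<gamma>"
    proof -
      obtain s where s: "s \<le> n" "\<gamma> = rot n s"
        using rots \<gamma>(1) by blast
      have "\<gamma> \<circ> rot n (n - s) = id" "rot n (n - s) \<circ> \<gamma> = id"
        using s rot_comp[of s n "n - s"] rot_comp[of "n - s" n s] by (auto simp: rot_self)
      then show ?thesis
        using o_bij by blast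
    qed
    then have "f \<circ> f = inv_into UNIV (\<gamma> \<circ> \<gamma>)"
      using \<gamma>(2) by (simp add: o_inv_distrib)
    moreover have "\<gamma> \<circ> \<gamma> \<in> \<Gamma>"
      using subgroup.m_closed[OF assms(1) \<gamma>(1) \<gamma>(1)] by (simp add: mult_cyclic_perm_group)
    ultimately show "f \<circ> f \<in> inv_into UNIV ` \<Gamma>"
      by blast
  next
    fix f and b :: real assume "f \<in> inv_into UNIV ` \<Gamma>" and b: "b \<in> {0, 1}"
    then obtain \<gamma> where \<gamma>: "\<gamma> \<in> \<Gamma>" "f = inv_into UNIV \<gamma>"
      by blast
    \<comment> \<open>Completeness is applied to the opposite value \<open>1 - b\<close>; as entries
      are binary, \<open>z p = b\<close>.\<close>
    then obtain z where z: "z \<in> lex_max_perm n \<gamma> \<inter> face n I0 I1" "z p \<noteq> 1 - b"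
      using assms(6) p b unfolding complete_fixings_def by fastforce
    moreover have "z p \<in> {0, 1}"
      using z(1) p by (auto simp: face_def cube_def)
    ultimately show "\<exists>z\<in>face n I0 I1. z p = b \<and> \<not> less_fun z (z \<circ> f)"
      using b \<gamma>(2) by (auto simp: lex_max_perm_def act)
  qed (use assms(5) p below in auto)
  obtain x where x: "x \<in> face n I0 I1"
    "\<forall>f\<in>inv_into UNIV ` \<Gamma> - {id}. less_fun (x \<circ> f) x"
    using strict_solution assms(2,3) by blast
  have "inv_into UNIV \<gamma> \<noteq> id" if \<gamma>: "\<gamma> \<in> \<Gamma> - {id}" for \<gamma>
  proof -
    obtain s where s: "s \<le> n" "\<gamma> = rot n s"
      using rots \<gamma> by blast
    then have "inv_into UNIV \<gamma> \<circ> \<gamma> = id"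
      using inv_rot[of s n] rot_comp[of "n - s" n s] by (simp add: rot_self)
    then show ?thesis
      using \<gamma> by auto
  qed
  then show ?thesis
    using x by (auto simp: act)
qed

end
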